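(* Let $\mathcal{H}_A$ and $\mathcal{H}_B$ be finite-dimensional complex Hilbert spaces with $\dim\mathcal{H}_A=n\ge 1$, and let $|\psi\rangle,|\phi\rangle\in\mathcal{H}_A\otimes\mathcal{H}_B$ be unit vectors with $\langle\psi|\phi\rangle=0$. Then there exist an integer $l\ge n$, a Hilbert space $\mathcal{H}_{A'}$ of dimension $l$, a linear isometry $V:\mathcal{H}_A\to\mathcal{H}_{A'}$, an orthonormal basis $|1\rangle_{A'},\dots,|l\rangle_{A'}$ of $\mathcal{H}_{A'}$, and (not necessarily normalized, possibly zero) vectors $|\eta_1\rangle,\dots,|\eta_l\rangle$ and $|\eta_1^\perp\rangle,\dots,|\eta_l^\perp\rangle$ in $\mathcal{H}_B$ such that $$(V\otimes I)|\psi\rangle=\sum_{i=1}^{l}|i\rangle_{A'}\otimes|\eta_i\rangle,\qquad (V\otimes I)|\phi\rangle=\sum_{i=1}^{l}|i\rangle_{A'}\otimes|\eta_i^\perp\rangle,$$ and $\langle\eta_i|\eta_i^\perp\rangle=0$ for every $i=1,\dots,l$.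
   Context: The isometry $V$ formalizes the transfer of Alice's $n$-dimensional system into an $n$-dimensional subspace of a possibly larger $l$-dimensional system $A'$. The symbol $|\eta_i^\perp\rangle$ is just a name for a vector of $\mathcal{H}_B$; its only required relation to $|\eta_i\rangle$ is orthogonality. *)

theory Defs
  imports Complex_Main "HOL-Library.Poly_Mapping"
begin

section \<open>Complex vector spaces and inner product spaces\<close>

class scaleC =
  fixes scaleC :: "complex \<Rightarrow> 'a \<Rightarrow> 'a"  (infixr \<open>*\<^sub>C\<close> 75)

class complex_vector = scaleC + ab_group_add +
  assumes scaleC_add_right: "a *\<^sub>C (x + y) = a *\<^sub>C x + a *\<^sub>C y"
    and scaleC_add_left: "(a + b) *\<^sub>C x = a *\<^sub>C x + b *\<^sub>C x"
    and scaleC_scaleC: "a *\<^sub>C (b *\<^sub>C x) = (a * b) *\<^sub>C x"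
    and scaleC_one: "1 *\<^sub>C x = x"

global_interpretation complex_vector: vector_space "scaleC :: complex \<Rightarrow> 'a \<Rightarrow> 'a::complex_vector"
  defines csubspace_raw_def: csubspace = complex_vector.subspace
    and cspan_raw_def: cspan = complex_vector.span
    and cdim_raw_def: cdim = complex_vector.dim
  by unfold_locales (simp_all add: scaleC_add_right scaleC_add_left scaleC_scaleC scaleC_one)

abbreviation clinear :: "('a::complex_vector \<Rightarrow> 'b::complex_vector) \<Rightarrow> bool"
  where "clinear \<equiv> Vector_Spaces.linear scaleC scaleC"

text \<open>As in bra-ket notation, the inner product is conjugate-linear in its first argument.\<close>

class complex_inner = complex_vector +
  fixes cinner :: "'a \<Rightarrow> 'a \<Rightarrow> complex"
  assumes cinner_commute: "cinner x y = cnj (cinner y x)"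
    and cinner_add_right: "cinner x (y + z) = cinner x y + cinner x z"
    and cinner_scaleC_right: "cinner x (a *\<^sub>C y) = a * cinner x y"
    and cinner_ge_zero: "0 \<le> Re (cinner x x)"
    and cinner_eq_zero_iff: "cinner x x = 0 \<longleftrightarrow> x = 0"

definition cnorm :: "'a::complex_inner \<Rightarrow> real"
  where "cnorm x = sqrt (Re (cinner x x))"

text \<open>Completeness is automatic in finite dimension, so a finite-dimensional subspace of a
  complex inner product space is the same as a finite-dimensional complex Hilbert space.\<close>

definition finite_dimensional :: "'a::complex_vector set \<Rightarrow> bool"
  where "finite_dimensional H \<longleftrightarrow> (\<exists>B. finite B \<and> cspan B = H)"

definition is_isometry :: "('a::complex_inner \<Rightarrow> 'b::complex_inner) \<Rightarrow> bool"
  where "is_isometry V \<longleftrightarrow> clinear V \<and> (\<forall>x. cnorm (V x) = cnorm x)"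

definition is_orthonormal_basis ::
    "(nat \<Rightarrow> 'a::complex_inner) \<Rightarrow> nat \<Rightarrow> 'a set \<Rightarrow> bool"
  where "is_orthonormal_basis e l H \<longleftrightarrow>
    (\<forall>i\<in>{1..l}. \<forall>j\<in>{1..l}. cinner (e i) (e j) = (if i = j then 1 else 0)) \<and>
    cspan (e ` {1..l}) = H"

lemma cinner_add_left: "cinner (x + y) z = cinner x z + cinner y z"
  for x :: "'a::complex_inner"
  by (metis cinner_commute cinner_add_right complex_cnj_add)

lemma cinner_scaleC_left: "cinner (a *\<^sub>C x) y = cnj a * cinner x y"
  for x :: "'a::complex_inner"
  by (metis cinner_commute cinner_scaleC_right complex_cnj_mult)

lemma cinner_zero_right [simp]: "cinner x 0 = 0"
  for x :: "'a::complex_inner"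
  using cinner_add_right[of x 0 0] by simp

lemma cinner_zero_left [simp]: "cinner 0 x = 0"
  for x :: "'a::complex_inner"
  using cinner_add_left[of 0 0 x] by simp

lemma cinner_minus_right: "cinner x (- y) = - cinner x y"
  for x :: "'a::complex_inner"
  using cinner_add_right[of x y "- y"] by (simp add: eq_neg_iff_add_eq_0 add.commute)

lemma cinner_diff_right: "cinner x (y - z) = cinner x y - cinner x z"
  for x :: "'a::complex_inner"
  using cinner_add_right[of x y "- z"] by (simp add: cinner_minus_right)

lemma cinner_sum_right: "cinner x (sum f A) = (\<Sum>i\<in>A. cinner x (f i))"
  for x :: "'a::complex_inner"
  by (induction A rule: infinite_finite_induct) (simp_all add: cinner_add_right)

lemma cinner_eqI:
  fixes x y :: "'a::complex_inner"
  assumes "\<And>u. cinner u x = cinner u y"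
  shows "x = y"
proof -
  have "cinner (x - y) (x - y) = 0" by (simp add: cinner_diff_right assms)
  then show ?thesis by (simp add: cinner_eq_zero_iff)
qed


section \<open>Finitely supported complex sequences\<close>

instantiation complex :: complex_inner
begin

definition scaleC_complex :: "complex \<Rightarrow> complex \<Rightarrow> complex"
  where "scaleC_complex = (*)"

definition cinner_complex :: "complex \<Rightarrow> complex \<Rightarrow> complex"
  where "cinner_complex x y = cnj x * y"

instance
  by standard (auto simp: scaleC_complex_def cinner_complex_def algebra_simps)

end

text \<open>The space \<open>nat \<Rightarrow>\<^sub>0 complex\<close> of finitely supported sequences has subspaces
  of every finite dimension, so every finite-dimensional complex Hilbert space is isometrically
  isomorphic to one of its subspaces.\<close>

instantiation poly_mapping :: (type, complex_inner) complex_inner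
begin

definition scaleC_poly_mapping ::
    "complex \<Rightarrow> ('a \<Rightarrow>\<^sub>0 'b) \<Rightarrow> 'a \<Rightarrow>\<^sub>0 'b"
  where "scaleC_poly_mapping a p = Poly_Mapping.map (scaleC a) p"

definition cinner_poly_mapping ::
    "('a \<Rightarrow>\<^sub>0 'b) \<Rightarrow> ('a \<Rightarrow>\<^sub>0 'b) \<Rightarrow> complex"
  where "cinner_poly_mapping p q = (\<Sum>k\<in>Poly_Mapping.keys p. cinner (Poly_Mapping.lookup p k) (Poly_Mapping.lookup q k))"

lemma lookup_scaleC: "Poly_Mapping.lookup (a *\<^sub>C p) k = a *\<^sub>C Poly_Mapping.lookup p k"
  for p :: "'a \<Rightarrow>\<^sub>0 'b"
  by (simp add: scaleC_poly_mapping_def Poly_Mapping.map.rep_eq when_def)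

lemma cinner_poly_mapping_superset:
  fixes p q :: "'a \<Rightarrow>\<^sub>0 'b"
  assumes "finite K" "Poly_Mapping.keys p \<subseteq> K"
  shows "cinner p q = (\<Sum>k\<in>K. cinner (Poly_Mapping.lookup p k) (Poly_Mapping.lookup q k))"
  unfolding cinner_poly_mapping_def
  by (rule sum.mono_neutral_left) (use assms in \<open>auto simp: in_keys_iff\<close>)

instance
proof
  fix a b :: complex and p q r :: "'a \<Rightarrow>\<^sub>0 'b"
  show "a *\<^sub>C (p + q) = a *\<^sub>C p + a *\<^sub>C q"
    and "(a + b) *\<^sub>C p = a *\<^sub>C p + b *\<^sub>C p"
    and "a *\<^sub>C (b *\<^sub>C p) = (a * b) *\<^sub>C p"
    and "1 *\<^sub>C p = p"
    by (auto intro!: poly_mapping_eqI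
        simp: lookup_scaleC lookup_add scaleC_add_right scaleC_add_left scaleC_scaleC scaleC_one)
  show "cinner p q = cnj (cinner q p)"
    by (simp add: cinner_poly_mapping_superset[of "Poly_Mapping.keys p \<union> Poly_Mapping.keys q"]
        flip: cinner_commute)
  show "cinner p (q + r) = cinner p q + cinner p r"
    by (simp add: cinner_poly_mapping_def lookup_add cinner_add_right sum.distrib)
  show "cinner p (a *\<^sub>C q) = a * cinner p q"
    by (simp add: cinner_poly_mapping_def lookup_scaleC cinner_scaleC_right sum_distrib_left)
  show "0 \<le> Re (cinner p p)"
    by (simp add: cinner_poly_mapping_def cinner_ge_zero sum_nonneg)
  show "cinner p p = 0 \<longleftrightarrow> p = 0"
  proof
    assume "cinner p p = 0"
    then have "(\<Sum>k\<in>Poly_Mapping.keys p. Re (cinner (Poly_Mapping.lookup p k) (Poly_Mapping.lookup p k))) = 0"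
      by (simp add: cinner_poly_mapping_def flip: Re_sum)
    then have 0: "\<forall>k\<in>Poly_Mapping.keys p. Re (cinner (Poly_Mapping.lookup p k) (Poly_Mapping.lookup p k)) = 0"
      by (simp add: sum_nonneg_eq_0_iff cinner_ge_zero)
    have "Poly_Mapping.lookup p k = 0" for k
    proof (cases "k \<in> Poly_Mapping.keys p")
      case True
      then have "Re (cinner (Poly_Mapping.lookup p k) (Poly_Mapping.lookup p k)) = 0" using 0 by simp
      moreover have "Im (cinner (Poly_Mapping.lookup p k) (Poly_Mapping.lookup p k)) = 0"
        using arg_cong[OF cinner_commute[of "Poly_Mapping.lookup p k" "Poly_Mapping.lookup p k"], of Im] by simp
      ultimately show ?thesis by (simp add: complex_eq_iff flip: cinner_eq_zero_iff)
    qed (simp add: in_keys_iff)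
    then show "p = 0" by (intro poly_mapping_eqI) simp
  qed (simp add: cinner_poly_mapping_def)
qed

end


section \<open>Tensor products\<close>

text \<open>The elementary tensor of \<open>x\<close> and \<open>y\<close> is the conjugate-bilinear form
  \<open>(u, v) \<mapsto> \<langle>u|x\<rangle>\<langle>v|y\<rangle>\<close>, and the tensor product consists of all finite sums of
  elementary tensors (Reed and Simon, Functional Analysis, Section II.4). No completion is taken:
  for finite-dimensional factors none is needed.\<close>

definition tensor_form ::
    "('a::complex_inner \<times> 'b::complex_inner) list \<Rightarrow> 'a \<Rightarrow> 'b \<Rightarrow> complex"
  where "tensor_form xs u v = (\<Sum>(x, y)\<leftarrow>xs. cinner u x * cinner v y)"

lemma tensor_form_Nil: "tensor_form [] u v = 0"
  and tensor_form_Cons: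
    "tensor_form ((x, y) # xs) u v = cinner u x * cinner v y + tensor_form xs u v"
  and tensor_form_append:
    "tensor_form (xs @ ys) u v = tensor_form xs u v + tensor_form ys u v"
  by (simp_all add: tensor_form_def)

lemma tensor_form_scaleC:
  "tensor_form (map (\<lambda>(x, y). (a *\<^sub>C x, y)) xs) u v = a * tensor_form xs u v"
  by (induction xs) (auto simp: tensor_form_Nil tensor_form_Cons cinner_scaleC_right algebra_simps)

typedef (overloaded) ('a, 'b) tensor =
    "range (tensor_form :: ('a::complex_inner \<times> 'b::complex_inner) list \<Rightarrow> 'a \<Rightarrow> 'b \<Rightarrow> complex)"
  morphisms form_of Abs_tensor
  by blast

definition tensor ::
    "'a::complex_inner \<Rightarrow> 'b::complex_inner \<Rightarrow> ('a, 'b) tensor"  (infixr \<open>\<otimes>\<^sub>C\<close> 72)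
  where "x \<otimes>\<^sub>C y = Abs_tensor (\<lambda>u v. cinner u x * cinner v y)"

definition tensor_rep ::
    "('a::complex_inner, 'b::complex_inner) tensor \<Rightarrow> ('a \<times> 'b) list"
  where "tensor_rep T = (SOME xs. form_of T = tensor_form xs)"

lemma form_of_tensor_rep: "form_of T = tensor_form (tensor_rep T)"
  unfolding tensor_rep_def by (rule someI_ex) (use form_of[of T] in auto)

lemma form_of_Abs_tensor:
  assumes "\<And>u v. f u v = tensor_form xs u v"
  shows "form_of (Abs_tensor f) u v = f u v"
proof -
  have "f = tensor_form xs" using assms by (intro ext)
  then show ?thesis by (simp add: Abs_tensor_inverse)
qed

lemma tensor_eqI: "(\<And>u v. form_of S u v = form_of T u v) \<Longrightarrow> S = T"
  by (metis ext form_of_inject)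

instantiation tensor :: (complex_inner, complex_inner) complex_inner
begin

definition zero_tensor :: "('a, 'b) tensor"
  where "0 = Abs_tensor (\<lambda>u v. 0)"

definition plus_tensor :: "('a, 'b) tensor \<Rightarrow> ('a, 'b) tensor \<Rightarrow> ('a, 'b) tensor"
  where "S + T = Abs_tensor (\<lambda>u v. form_of S u v + form_of T u v)"

definition scaleC_tensor :: "complex \<Rightarrow> ('a, 'b) tensor \<Rightarrow> ('a, 'b) tensor"
  where "a *\<^sub>C T = Abs_tensor (\<lambda>u v. a * form_of T u v)"

definition uminus_tensor :: "('a, 'b) tensor \<Rightarrow> ('a, 'b) tensor"
  where "- T = (- 1) *\<^sub>C T" for T :: "('a, 'b) tensor"

definition minus_tensor :: "('a, 'b) tensor \<Rightarrow> ('a, 'b) tensor \<Rightarrow> ('a, 'b) tensor"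
  where "S - T = S + - T" for S :: "('a, 'b) tensor"

text \<open>This is the sesquilinear extension of
  \<open>\<langle>x \<otimes> y|x' \<otimes> y'\<rangle> = \<langle>x|x'\<rangle>\<langle>y|y'\<rangle>\<close>; see \<open>cinner_tensor_tensor\<close> below.\<close>

definition cinner_tensor :: "('a, 'b) tensor \<Rightarrow> ('a, 'b) tensor \<Rightarrow> complex"
  where "cinner_tensor S T = (\<Sum>(x, y)\<leftarrow>tensor_rep S. form_of T x y)"

lemma form_of_zero: "form_of (0 :: ('a, 'b) tensor) u v = 0"
  unfolding zero_tensor_def
  by (rule form_of_Abs_tensor[of _ "[]"]) (simp add: tensor_form_Nil)

lemma form_of_plus: "form_of (S + T) u v = form_of S u v + form_of T u v"
  for S :: "('a, 'b) tensor"
  unfolding plus_tensor_def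
  by (rule form_of_Abs_tensor[of _ "tensor_rep S @ tensor_rep T"])
    (simp add: tensor_form_append form_of_tensor_rep)

lemma form_of_scaleC: "form_of (a *\<^sub>C T) u v = a * form_of T u v"
  for T :: "('a, 'b) tensor"
  unfolding scaleC_tensor_def
  by (rule form_of_Abs_tensor[of _ "map (\<lambda>(x, y). (a *\<^sub>C x, y)) (tensor_rep T)"])
    (simp add: tensor_form_scaleC form_of_tensor_rep)

lemma form_of_uminus: "form_of (- T) u v = - form_of T u v"
  for T :: "('a, 'b) tensor"
  by (simp add: uminus_tensor_def form_of_scaleC)

lemma form_of_minus: "form_of (S - T) u v = form_of S u v - form_of T u v"
  for S :: "('a, 'b) tensor"
  by (simp add: minus_tensor_def form_of_plus form_of_uminus)

lemma cnj_tensor_form: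
  "cnj (tensor_form xs u v) = (\<Sum>(x, y)\<leftarrow>xs. cinner x u * cinner y v)"
  for u :: 'a and v :: 'b
  by (induction xs)
    (auto simp: tensor_form_Nil tensor_form_Cons simp flip: cinner_commute)

lemma sum_list_tensor_form_commute:
  "(\<Sum>(x, y)\<leftarrow>xs. tensor_form ys x y) = cnj (\<Sum>(x, y)\<leftarrow>ys. tensor_form xs x y)"
  for xs ys :: "('a \<times> 'b) list"
proof (induction xs)
  case Nil
  then show ?case by (induction ys) (auto simp: tensor_form_Nil)
next
  case (Cons p xs)
  obtain x y where p: "p = (x, y)" by (cases p)
  have "cnj (\<Sum>(x', y')\<leftarrow>ys. tensor_form ((x, y) # xs) x' y')
      = tensor_form ys x y + cnj (\<Sum>(x', y')\<leftarrow>ys. tensor_form xs x' y')"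
    by (induction ys)
      (auto simp: tensor_form_Nil tensor_form_Cons simp flip: cinner_commute)
  then show ?case using Cons by (simp add: p)
qed

lemma cinner_tensor_eq:
  fixes S T :: "('a, 'b) tensor"
  assumes "form_of S = tensor_form xs"
  shows "cinner S T = (\<Sum>(x, y)\<leftarrow>xs. form_of T x y)"
proof -
  have "tensor_form (tensor_rep S) = tensor_form xs"
    using assms by (simp add: form_of_tensor_rep)
  then show ?thesis
    unfolding cinner_tensor_def form_of_tensor_rep[of T]
    by (subst (1 2) sum_list_tensor_form_commute) simp
qed

lemma tensor_form_orthonormal:
  fixes xs :: "('a \<times> 'b) list"
  shows "\<exists>F a. finite F \<and> (\<forall>f\<in>F. \<forall>g\<in>F. cinner f g = (if f = g then 1 else 0)) \<and>
    (\<forall>u v. tensor_form xs u v = (\<Sum>f\<in>F. cinner u (a f) * cinner v f))"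
proof (induction xs)
  case Nil
  show ?case by (rule exI[of _ "{}"]) (simp add: tensor_form_Nil)
next
  case (Cons p xs)
  obtain x y where p: "p = (x, y)" by (cases p)
  obtain F :: "'b set" and a where F: "finite F"
    and on: "\<And>f g. f \<in> F \<Longrightarrow> g \<in> F \<Longrightarrow> cinner f g = (if f = g then 1 else 0)"
    and xs: "\<And>u v. tensor_form xs u v = (\<Sum>f\<in>F. cinner u (a f) * cinner v f)"
    using Cons by blast
  define r where "r = y - (\<Sum>f\<in>F. cinner f y *\<^sub>C f)"
  define a' where "a' f = a f + cinner f y *\<^sub>C x" for f
  have y: "cinner v y = (\<Sum>f\<in>F. cinner f y * cinner v f) + cinner v r" for v
    by (simp add: r_def cinner_diff_right cinner_sum_right cinner_scaleC_right)
  have form: "tensor_form (p # xs) u v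
      = (\<Sum>f\<in>F. cinner u (a' f) * cinner v f) + cinner u x * cinner v r" for u v
    by (simp add: p tensor_form_Cons xs y[of v] a'_def cinner_add_right cinner_scaleC_right
        algebra_simps sum.distrib sum_distrib_left)
  have orth: "cinner g r = 0" if "g \<in> F" for g
  proof -
    have "(\<Sum>f\<in>F. cinner f y * cinner g f) = (\<Sum>f\<in>F. if f = g then cinner g y else 0)"
      by (rule sum.cong) (use that in \<open>auto simp: on\<close>)
    then show ?thesis using y[of g] that F by simp
  qed
  show ?case
  proof (cases "r = 0")
    case True
    then show ?thesis using F on form by (intro exI[of _ F] exI[of _ a']) simp
  next
    case False
    define c where "c = complex_of_real (sqrt (Re (cinner r r)))"
    have im: "Im (cinner r r) = 0"
      using arg_cong[OF cinner_commute[of r r], of Im] by simp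
    have c2: "c * c = cinner r r" and cc: "cnj c = c"
      using im cinner_ge_zero[of r] by (simp_all add: c_def complex_eq_iff)
    have c0: "c \<noteq> 0" using c2 False by (auto simp: cinner_eq_zero_iff)
    define h where "h = (1 / c) *\<^sub>C r"
    have hh: "cinner h h = 1"
      using c0 by (simp add: h_def cinner_scaleC_left cinner_scaleC_right cc flip: c2)
    have gh: "cinner g h = 0" if "g \<in> F" for g
      by (simp add: h_def cinner_scaleC_right orth that)
    have hg: "cinner h g = 0" if "g \<in> F" for g
      using gh[OF that] cinner_commute[of h g] by simp
    have hF: "h \<notin> F" using gh hh by force
    have r: "cinner v r = c * cinner v h" for v
      using c0 by (simp add: h_def cinner_scaleC_right)
    have "(\<Sum>f\<in>F. cinner u (a' f) * cinner v f)
        = (\<Sum>f\<in>F. cinner u ((a'(h := c *\<^sub>C x)) f) * cinner v f)" for u v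
      by (rule sum.cong) (use hF in auto)
    then have "tensor_form (p # xs) u v
        = (\<Sum>f\<in>insert h F. cinner u ((a'(h := c *\<^sub>C x)) f) * cinner v f)" for u v
      using F hF by (simp add: form r cinner_scaleC_right)
    then show ?thesis
      using F on hh gh hg
      by (intro exI[of _ "insert h F"] exI[of _ "a'(h := c *\<^sub>C x)"]) (auto simp: hF)
  qed
qed

lemma cinner_tensor_self:
  fixes T :: "('a, 'b) tensor"
  obtains F :: "'b set" and a where "finite F"
    and "\<And>u v. form_of T u v = (\<Sum>f\<in>F. cinner u (a f) * cinner v f)"
    and "cinner T T = (\<Sum>f\<in>F. cinner (a f) (a f))"
proof -
  obtain F :: "'b set" and a where F: "finite F"
    and on: "\<And>f g. f \<in> F \<Longrightarrow> g \<in> F \<Longrightarrow> cinner f g = (if f = g then 1 else 0)"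
    and T: "\<And>u v. form_of T u v = (\<Sum>f\<in>F. cinner u (a f) * cinner v f)"
    using tensor_form_orthonormal[of "tensor_rep T"] form_of_tensor_rep[of T] by metis
  have swap: "(\<Sum>(x, y)\<leftarrow>ys. \<Sum>f\<in>F. cinner x (a f) * cinner y f)
      = (\<Sum>f\<in>F. cnj (tensor_form ys (a f) f))" for ys
    by (induction ys) (auto simp: cnj_tensor_form sum.distrib)
  have "cinner T T = (\<Sum>f\<in>F. cnj (form_of T (a f) f))"
    by (simp only: cinner_tensor_def T swap flip: form_of_tensor_rep)
  also have "\<dots> = (\<Sum>f\<in>F. cinner (a f) (a f))"
  proof (rule sum.cong)
    fix f assume f: "f \<in> F"
    have "form_of T (a f) f = (\<Sum>g\<in>F. if g = f then cinner (a f) (a f) else 0)"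
      unfolding T by (rule sum.cong) (use f in \<open>auto simp: on\<close>)
    then show "cnj (form_of T (a f) f) = cinner (a f) (a f)"
      using f F cinner_commute[of "a f" "a f"] by simp
  qed simp
  finally show ?thesis using that F T by blast
qed

instance
proof
  fix a b :: complex and S T U :: "('a, 'b) tensor"
  show "S + T + U = S + (T + U)" "S + T = T + S" "0 + S = S" "- S + S = 0" "S - T = S + - T"
    "a *\<^sub>C (S + T) = a *\<^sub>C S + a *\<^sub>C T" "(a + b) *\<^sub>C S = a *\<^sub>C S + b *\<^sub>C S"
    "a *\<^sub>C (b *\<^sub>C S) = (a * b) *\<^sub>C S" "1 *\<^sub>C S = S"
    by (auto intro!: tensor_eqI simp: form_of_zero form_of_plus form_of_uminus form_of_minus
        form_of_scaleC algebra_simps)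
  show "cinner S T = cnj (cinner T S)"
    by (simp add: cinner_tensor_def form_of_tensor_rep[of S] form_of_tensor_rep[of T]
        sum_list_tensor_form_commute[of "tensor_rep S"])
  have "(\<Sum>(x, y)\<leftarrow>xs. form_of (T + U) x y)
      = (\<Sum>(x, y)\<leftarrow>xs. form_of T x y) + (\<Sum>(x, y)\<leftarrow>xs. form_of U x y)" for xs
    by (induction xs) (auto simp: form_of_plus)
  then show "cinner S (T + U) = cinner S T + cinner S U"
    by (simp add: cinner_tensor_def)
  have "(\<Sum>(x, y)\<leftarrow>xs. form_of (a *\<^sub>C T) x y) = a * (\<Sum>(x, y)\<leftarrow>xs. form_of T x y)" for xs
    by (induction xs) (auto simp: form_of_scaleC algebra_simps)
  then show "cinner S (a *\<^sub>C T) = a * cinner S T"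
    by (simp add: cinner_tensor_def)
  obtain F :: "'b set" and e where F: "finite F"
    and T: "\<And>u v. form_of T u v = (\<Sum>f\<in>F. cinner u (e f) * cinner v f)"
    and TT: "cinner T T = (\<Sum>f\<in>F. cinner (e f) (e f))"
    using cinner_tensor_self[of T] by blast
  show "0 \<le> Re (cinner T T)"
    by (simp add: TT cinner_ge_zero sum_nonneg)
  show "cinner T T = 0 \<longleftrightarrow> T = 0"
  proof
    assume "cinner T T = 0"
    then have "(\<Sum>f\<in>F. Re (cinner (e f) (e f))) = 0"
      by (simp add: TT flip: Re_sum)
    then have 0: "\<forall>f\<in>F. Re (cinner (e f) (e f)) = 0"
      using F by (simp add: sum_nonneg_eq_0_iff cinner_ge_zero)
    have "e f = 0" if "f \<in> F" for f
    proof -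
      have "Im (cinner (e f) (e f)) = 0"
        using arg_cong[OF cinner_commute[of "e f" "e f"], of Im] by simp
      then show ?thesis using 0 that by (simp add: complex_eq_iff flip: cinner_eq_zero_iff)
    qed
    then show "T = 0" by (intro tensor_eqI) (simp add: T form_of_zero)
  next
    assume T0: "T = 0"
    have "(\<Sum>(x, y)\<leftarrow>xs. form_of (0 :: ('a, 'b) tensor) x y) = 0" for xs
      by (induction xs) (auto simp: form_of_zero)
    then show "cinner T T = 0" by (simp add: cinner_tensor_def T0)
  qed
qed

end

lemma form_of_tensor: "form_of (x \<otimes>\<^sub>C y) u v = cinner u x * cinner v y"
  unfolding tensor_def
  by (rule form_of_Abs_tensor[of _ "[(x, y)]"]) (simp add: tensor_form_Nil tensor_form_Cons)

lemma tensor_add_left: "(x + x') \<otimes>\<^sub>C y = x \<otimes>\<^sub>C y + x' \<otimes>\<^sub>C y"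
  and tensor_add_right: "x \<otimes>\<^sub>C (y + y') = x \<otimes>\<^sub>C y + x \<otimes>\<^sub>C y'"
  and tensor_scaleC_left: "(a *\<^sub>C x) \<otimes>\<^sub>C y = a *\<^sub>C (x \<otimes>\<^sub>C y)"
  and tensor_scaleC_right: "x \<otimes>\<^sub>C (a *\<^sub>C y) = a *\<^sub>C (x \<otimes>\<^sub>C y)"
  by (auto intro!: tensor_eqI simp: form_of_tensor form_of_plus form_of_scaleC
      cinner_add_right cinner_scaleC_right algebra_simps)

lemma cinner_tensor_tensor:
  "cinner (x \<otimes>\<^sub>C y) (x' \<otimes>\<^sub>C y') = cinner x x' * cinner y y'"
proof -
  have "form_of (x \<otimes>\<^sub>C y) = tensor_form [(x, y)]"
    by (simp add: fun_eq_iff tensor_form_Nil tensor_form_Cons form_of_tensor)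
  then show ?thesis by (simp add: cinner_tensor_eq form_of_tensor)
qed

lemma form_of_sum_list:
  "form_of (\<Sum>(x, y)\<leftarrow>xs. x \<otimes>\<^sub>C y) = tensor_form xs"
  by (induction xs) (auto simp: fun_eq_iff form_of_zero form_of_plus form_of_tensor
      tensor_form_Nil tensor_form_Cons)

lemma tensor_sum_list: "T = (\<Sum>(x, y)\<leftarrow>tensor_rep T. x \<otimes>\<^sub>C y)"
  by (rule tensor_eqI) (simp only: form_of_sum_list flip: form_of_tensor_rep)

text \<open>The operator \<open>V \<otimes> W\<close>; the theorem \<open>tensor_op_ex1\<close> shows that the description is
  proper.\<close>

definition tensor_op ::
    "('a::complex_inner \<Rightarrow> 'c::complex_inner) \<Rightarrow> ('b::complex_inner \<Rightarrow> 'd::complex_inner)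
      \<Rightarrow> ('a, 'b) tensor \<Rightarrow> ('c, 'd) tensor"
  where "tensor_op V W =
    (THE F. clinear F \<and> (\<forall>x y. F (x \<otimes>\<^sub>C y) = V x \<otimes>\<^sub>C W y))"

lemma clinear_iff:
  "clinear f \<longleftrightarrow> (\<forall>x y. f (x + y) = f x + f y) \<and> (\<forall>a x. f (a *\<^sub>C x) = a *\<^sub>C f x)"
  for f :: "'a::complex_vector \<Rightarrow> 'b::complex_vector"
  unfolding Vector_Spaces.linear_iff by (simp add: complex_vector.vector_space_axioms)

lemma tensor_form_map_left:
  fixes V :: "'a::complex_inner \<Rightarrow> 'c::complex_inner" and xs xs' :: "('a \<times> 'b::complex_inner) list"
  assumes V: "clinear V" and eq: "tensor_form xs = tensor_form xs'"
  shows "tensor_form (map (\<lambda>(x, y). (V x, y)) xs) = tensor_form (map (\<lambda>(x, y). (V x, y)) xs')"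
proof -
  define p where "p xs v = (\<Sum>(x, y)\<leftarrow>xs. cinner v y *\<^sub>C x)"
    for xs :: "('a \<times> 'b) list" and v
  have form: "cinner u (p xs v) = tensor_form xs u v" for xs u v
    by (induction xs) (auto simp: p_def tensor_form_Nil tensor_form_Cons cinner_add_right
        cinner_scaleC_right mult.commute)
  have V0: "V 0 = 0" using V complex_vector.scale_zero_left[of 0] unfolding clinear_iff
    by (metis complex_vector.scale_zero_left)
  have map: "tensor_form (map (\<lambda>(x, y). (V x, y)) xs) u v = cinner u (V (p xs v))" for xs u v
    using V unfolding clinear_iff
    by (induction xs) (auto simp: p_def V0 tensor_form_Nil tensor_form_Cons cinner_add_right
        cinner_scaleC_right mult.commute)
  have "p xs v = p xs' v" for v by (rule cinner_eqI) (simp add: form eq)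
  then show ?thesis by (simp add: fun_eq_iff map)
qed

lemma tensor_form_map_right:
  fixes W :: "'b::complex_inner \<Rightarrow> 'd::complex_inner" and xs xs' :: "('a::complex_inner \<times> 'b) list"
  assumes W: "clinear W" and eq: "tensor_form xs = tensor_form xs'"
  shows "tensor_form (map (\<lambda>(x, y). (x, W y)) xs) = tensor_form (map (\<lambda>(x, y). (x, W y)) xs')"
proof -
  have swap: "tensor_form (map prod.swap ys) v u = tensor_form ys u v"
    for ys :: "('e::complex_inner \<times> 'f::complex_inner) list" and u v
    by (induction ys) (auto simp: tensor_form_Nil tensor_form_Cons)
  have "tensor_form (map prod.swap xs) = tensor_form (map prod.swap xs')"
    by (simp add: fun_eq_iff swap eq)
  then have "tensor_form (map (\<lambda>(x, y). (W x, y)) (map prod.swap xs)) v u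
      = tensor_form (map (\<lambda>(x, y). (W x, y)) (map prod.swap xs')) v u" for u v
    using tensor_form_map_left[OF W] by metis
  moreover have "map (\<lambda>(x, y). (W x, y)) (map prod.swap ys)
      = map prod.swap (map (\<lambda>(x, y). (x, W y)) ys)" for ys :: "('a \<times> 'b) list"
    by auto
  ultimately show ?thesis by (simp only: fun_eq_iff swap) simp
qed

theorem tensor_op_ex1:
  fixes V :: "'a::complex_inner \<Rightarrow> 'c::complex_inner"
    and W :: "'b::complex_inner \<Rightarrow> 'd::complex_inner"
  assumes V: "clinear V" and W: "clinear W"
  shows "\<exists>!F. clinear F \<and> (\<forall>x y. F (x \<otimes>\<^sub>C y) = V x \<otimes>\<^sub>C W y)"
proof (rule ex_ex1I)
  let ?m = "map (\<lambda>(x, y). (V x, W y))"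
  define F where "F T = (\<Sum>(x, y)\<leftarrow>?m (tensor_rep T). x \<otimes>\<^sub>C y)" for T
  have cong: "tensor_form (?m xs) = tensor_form (?m xs')"
    if eq: "tensor_form xs = tensor_form xs'" for xs xs'
  proof -
    have *: "?m ys = map (\<lambda>(x, y). (V x, y)) (map (\<lambda>(x, y). (x, W y)) ys)" for ys by auto
    show ?thesis
      unfolding * by (intro tensor_form_map_left[OF V] tensor_form_map_right[OF W] eq)
  qed
  have F: "form_of (F T) = tensor_form (?m xs)" if "form_of T = tensor_form xs" for T xs
    unfolding F_def form_of_sum_list
    by (rule cong) (simp add: that flip: form_of_tensor_rep)
  have add: "F (S + T) = F S + F T" for S T
  proof (rule tensor_eqI)
    fix u v
    have "form_of (S + T) = tensor_form (tensor_rep S @ tensor_rep T)"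
      by (intro ext) (simp only: form_of_plus tensor_form_append flip: form_of_tensor_rep)
    from F[OF this] show "form_of (F (S + T)) u v = form_of (F S + F T) u v"
      by (simp add: form_of_plus tensor_form_append F[OF form_of_tensor_rep])
  qed
  have scale: "F (a *\<^sub>C T) = a *\<^sub>C F T" for a T
  proof (rule tensor_eqI)
    fix u v
    have "form_of (a *\<^sub>C T) = tensor_form (map (\<lambda>(x, y). (a *\<^sub>C x, y)) (tensor_rep T))"
      by (intro ext) (simp only: form_of_scaleC tensor_form_scaleC flip: form_of_tensor_rep)
    from F[OF this]
    have "form_of (F (a *\<^sub>C T)) = tensor_form (?m (map (\<lambda>(x, y). (a *\<^sub>C x, y)) (tensor_rep T)))" .
    also have "?m (map (\<lambda>(x, y). (a *\<^sub>C x, y)) (tensor_rep T))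
        = map (\<lambda>(x, y). (a *\<^sub>C x, y)) (?m (tensor_rep T))"
      using V by (auto simp: clinear_iff)
    finally show "form_of (F (a *\<^sub>C T)) u v = form_of (a *\<^sub>C F T) u v"
      by (simp only: tensor_form_scaleC form_of_scaleC F[OF form_of_tensor_rep])
  qed
  have "F (x \<otimes>\<^sub>C y) = V x \<otimes>\<^sub>C W y" for x y
  proof (rule tensor_eqI)
    fix u v
    have "form_of (x \<otimes>\<^sub>C y) = tensor_form [(x, y)]"
      by (simp add: fun_eq_iff tensor_form_Nil tensor_form_Cons form_of_tensor)
    from F[OF this] show "form_of (F (x \<otimes>\<^sub>C y)) u v = form_of (V x \<otimes>\<^sub>C W y) u v"
      by (simp add: tensor_form_Nil tensor_form_Cons form_of_tensor)
  qed
  then show "\<exists>F. clinear F \<and> (\<forall>x y. F (x \<otimes>\<^sub>C y) = V x \<otimes>\<^sub>C W y)"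
    using add scale by (auto simp: clinear_iff)
next
  fix F G :: "('a, 'b) tensor \<Rightarrow> ('c, 'd) tensor"
  assume F: "clinear F \<and> (\<forall>x y. F (x \<otimes>\<^sub>C y) = V x \<otimes>\<^sub>C W y)"
    and G: "clinear G \<and> (\<forall>x y. G (x \<otimes>\<^sub>C y) = V x \<otimes>\<^sub>C W y)"
  have "F 0 = 0" "G 0 = 0"
    using F G unfolding clinear_iff by (metis complex_vector.scale_zero_left)+
  then have "F (\<Sum>(x, y)\<leftarrow>xs. x \<otimes>\<^sub>C y) = G (\<Sum>(x, y)\<leftarrow>xs. x \<otimes>\<^sub>C y)" for xs
    using F G by (induction xs) (auto simp: clinear_iff)
  then show "F = G" using tensor_sum_list by (metis ext)
qed

lemma
  assumes "clinear V" "clinear W"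
  shows clinear_tensor_op: "clinear (tensor_op V W)"
    and tensor_op_tensor: "tensor_op V W (x \<otimes>\<^sub>C y) = V x \<otimes>\<^sub>C W y"
  using theI'[OF tensor_op_ex1[OF assms]] unfolding tensor_op_def by blast+

end

theory Submission
  imports Defs
begin

text \<open>
  Suppose \<open>f\<^sub>1, \<dots>, f\<^sub>l\<close> is a Parseval frame of \<open>\<H>\<^sub>A\<close>, that is,
  \<open>\<Sum>\<^sub>i |f\<^sub>i\<rangle>\<langle>f\<^sub>i| = I\<close>. Then \<open>V x = \<Sum>\<^sub>i \<langle>f\<^sub>i|x\<rangle> |i\<rangle>\<close> is an isometry and the components of
  \<open>(V \<otimes> I)|\<psi>\<rangle>\<close> are \<open>\<eta>\<^sub>i = (\<langle>f\<^sub>i| \<otimes> I)|\<psi>\<rangle>\<close>. So it suffices to find a Parseval frame on which the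
  diagonal of the sesquilinear form
  \<open>B(u, v) = \<langle>(\<langle>v| \<otimes> I)\<psi>|(\<langle>u| \<otimes> I)\<phi>\<rangle>\<close> vanishes. On every Parseval frame
  the diagonal of \<open>B\<close> sums to \<open>\<langle>\<psi>|\<phi>\<rangle> = 0\<close>. Two vectors \<open>u, v\<close> can be replaced by a unitary
  combination \<open>u', v'\<close> with \<open>B(u', u') = B(v', v')\<close> without changing
  \<open>|u\<rangle>\<langle>u| + |v\<rangle>\<langle>v|\<close>. Starting from an orthonormal basis padded with zeros to length \<open>2\<^sup>k\<close>, \<open>k\<close> rounds
  of pairwise mixing make all diagonal values equal, hence zero.
\<close>

section \<open>Equalizing the diagonal of a sesquilinear form\<close>

text \<open>The vector (b, -a) is orthogonal to (a, b); scaled to length one it is a point (cos t,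
  sin t) of the unit circle.\<close>

lemma ex_cos_sin_zero: "\<exists>t::real. a * cos t + b * sin t = 0"
proof (cases "a = 0 \<and> b = 0")
  case False
  then have s: "a\<^sup>2 + b\<^sup>2 > 0" by (simp add: sum_power2_gt_zero_iff)
  let ?r = "sqrt (a\<^sup>2 + b\<^sup>2)"
  have "(b / ?r)\<^sup>2 + (- a / ?r)\<^sup>2 = 1"
    using s by (auto simp: power_divide simp flip: add_divide_distrib)
  then obtain t where "b / ?r = cos t" "- a / ?r = sin t"
    by (metis sincos_total_2pi)
  then have "a * cos t + b * sin t = a * (b / ?r) + b * (- a / ?r)" by simp
  also have "\<dots> = 0" by simp
  finally show ?thesis ..
qed simp

definition sesquilinear :: "('a::complex_inner \<Rightarrow> 'a \<Rightarrow> complex) \<Rightarrow> bool"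
  where "sesquilinear B \<longleftrightarrow>
    (\<forall>u v w. B u (v + w) = B u v + B u w) \<and> (\<forall>u v w. B (u + v) w = B u w + B v w) \<and>
    (\<forall>u v a. B u (a *\<^sub>C v) = a * B u v) \<and> (\<forall>u v a. B (a *\<^sub>C u) v = cnj a * B u v)"

text \<open>On the diagonal u = v this form is the matrix element <y|u><u|x> of |u><u|, so an
  identity between diagonals of all sesquilinear forms yields one between sums of such
  projectors.\<close>

lemma sesquilinear_cinner: "sesquilinear (\<lambda>u v. cinner u x * cinner y v)"
  by (simp add: sesquilinear_def cinner_add_left cinner_add_right cinner_scaleC_left
      cinner_scaleC_right algebra_simps)

lemma sesquilinear_combination:
  assumes "sesquilinear B"
  shows "B (a *\<^sub>C u + b *\<^sub>C v) (a *\<^sub>C u + b *\<^sub>C v)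
    = cnj a * a * B u u + cnj b * b * B v v + cnj a * b * B u v + cnj b * a * B v u"
  using assms by (simp add: sesquilinear_def algebra_simps)

text \<open>Unitary mixing of u and v preserves |u><u| + |v><v|, hence also the sum of the two
  diagonal values. A phase and an angle suffice to make their difference vanish, so each becomes the
  mean.\<close>

lemma equalize_pair:
  assumes B: "sesquilinear B"
  shows "\<exists>u' v'. B u' u' = (B u u + B v v) / 2 \<and> B v' v' = (B u u + B v v) / 2 \<and>
    (\<forall>x y. cinner x u' * cinner u' y + cinner x v' * cinner v' y
      = cinner x u * cinner u y + cinner x v * cinner v y)"
proof (cases "B u u = B v v")
  case True
  then show ?thesis by (intro exI[of _ u] exI[of _ v]) simp
next
  case False
  define d where "d = B u u - B v v"
  have d: "d \<noteq> 0" using False by (simp add: d_def)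
  define \<beta> \<gamma> where "\<beta> = B u v / d" and "\<gamma> = B v u / d"
  \<comment> \<open>The phase makes the cross term of the rotated form a real multiple of \<open>d\<close>; a real rotation
    angle can then cancel it against \<open>d\<close>.\<close>
  obtain \<omega> where \<omega>: "(Im \<beta> + Im \<gamma>) * cos \<omega> + (Re \<beta> - Re \<gamma>) * sin \<omega> = 0"
    using ex_cos_sin_zero by blast
  define w where "w = cis \<omega>"
  have w: "cnj w * w = 1" by (simp add: w_def cis_cnj cis_mult)
  define r where "r = Re (w * \<beta> + cnj w * \<gamma>)"
  have "Im (w * \<beta> + cnj w * \<gamma>) = 0"
    using \<omega> by (simp add: w_def algebra_simps)
  then have "w * \<beta> + cnj w * \<gamma> = of_real r"
    by (simp add: r_def complex_eq_iff)
  then have "(w * \<beta> + cnj w * \<gamma>) * d = of_real r * d" by simp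
  then have E: "w * B u v + cnj w * B v u = of_real r * d"
    using d by (simp add: \<beta>_def \<gamma>_def algebra_simps)
  \<comment> \<open>With c = cos(t/2) and s = sin(t/2) below, \<open>B u' u' - B v' v'\<close>
    equals (c^2 - s^2 + 2 r s c) d = (cos t + r sin t) d.\<close>
  obtain t where t: "1 * cos t + r * sin t = 0"
    using ex_cos_sin_zero by blast
  define c s where "c = cos (t / 2)" and "s = sin (t / 2)"
  have cs1: "c\<^sup>2 + s\<^sup>2 = 1" by (simp add: c_def s_def)
  have "c\<^sup>2 - s\<^sup>2 + r * (2 * s * c) = 0"
    using t cos_double[of "t / 2"] sin_double[of "t / 2"] by (simp add: c_def s_def)
  then have "complex_of_real (c\<^sup>2 - s\<^sup>2 + r * (2 * s * c)) = 0" by simp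
  then have cs2: "of_real c ^ 2 - of_real s ^ 2 + of_real r * (2 * of_real s * of_real c) = (0::complex)"
    by simp
  have cs1': "of_real c ^ 2 + of_real s ^ 2 = (1::complex)"
    using cs1 by (metis of_real_1 of_real_add of_real_power)
  define u' v' where "u' = of_real c *\<^sub>C u + (of_real s * w) *\<^sub>C v"
    and "v' = (- of_real s * cnj w) *\<^sub>C u + of_real c *\<^sub>C v"
  \<comment> \<open>Stated for an arbitrary form \<open>C\<close>, because it serves both
    \<open>B\<close> and the rank-one forms that give the projector identity.\<close>
  have u': "C u' u' = of_real c ^ 2 * C u u + of_real s ^ 2 * C v v
      + of_real c * of_real s * (w * C u v + cnj w * C v u)"
    and v': "C v' v' = of_real s ^ 2 * C u u + of_real c ^ 2 * C v v
      - of_real c * of_real s * (w * C u v + cnj w * C v u)"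
    if "sesquilinear C" for C
    unfolding u'_def v'_def sesquilinear_combination[OF that] complex_cnj_mult complex_cnj_minus
      complex_cnj_complex_of_real complex_cnj_cnj using w
    by algebra+
  have "B u' u' = (B u u + B v v) / 2"
  proof -
    have "2 * B u' u' = B u u + B v v"
      unfolding u'[OF B] E d_def using cs1' cs2 by algebra
    then show ?thesis by (simp add: mult.commute)
  qed
  moreover have "B v' v' = (B u u + B v v) / 2"
  proof -
    have "2 * B v' v' = B u u + B v v"
      unfolding v'[OF B] E d_def using cs1' cs2 by algebra
    then show ?thesis by (simp add: mult.commute)
  qed
  moreover have "cinner x u' * cinner u' y + cinner x v' * cinner v' y
      = cinner x u * cinner u y + cinner x v * cinner v y" for x y
  proof -
    have "C u' u' + C v' v' = C u u + C v v" if "sesquilinear C" for C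
      unfolding u'[OF that] v'[OF that] using cs1' by algebra
    from this[OF sesquilinear_cinner[of y x]] show ?thesis by (simp add: mult.commute)
  qed
  ultimately show ?thesis by blast
qed

lemma sum_lessThan_add:
  "(\<Sum>i<m + k. f i) = (\<Sum>i<m. f i) + (\<Sum>i<k. f (m + i))" for f :: "nat \<Rightarrow> 'a::comm_monoid_add"
  by (induction k) (simp_all add: add.assoc)

text \<open>Each half is equalized by induction, then the i-th members of the two halves are mixed.
  The halves have equal length, so the mean of their averages is the average of the whole family;
  hence the length \<open>2 ^ k\<close>.\<close>

lemma equalize_family:
  fixes f :: "nat \<Rightarrow> 'a::complex_inner"
  assumes B: "sesquilinear B"
  shows "\<exists>g. (\<forall>i<(2::nat) ^ k. B (g i) (g i) = (\<Sum>j<2 ^ k. B (f j) (f j)) / 2 ^ k) \<and>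
    (\<forall>x y. (\<Sum>i<(2::nat) ^ k. cinner x (g i) * cinner (g i) y)
      = (\<Sum>i<2 ^ k. cinner x (f i) * cinner (f i) y))"
proof (induction k arbitrary: f)
  case 0
  show ?case by (rule exI[of _ f]) simp
next
  case (Suc k)
  let ?N = "2 ^ k :: nat"
  obtain g where g: "\<And>i. i < ?N \<Longrightarrow> B (g i) (g i) = (\<Sum>j<?N. B (f j) (f j)) / 2 ^ k"
    and gP: "\<And>x y. (\<Sum>i<?N. cinner x (g i) * cinner (g i) y)
      = (\<Sum>i<?N. cinner x (f i) * cinner (f i) y)"
    using Suc[of f] by blast
  obtain h where h: "\<And>i. i < ?N \<Longrightarrow> B (h i) (h i) = (\<Sum>j<?N. B (f (?N + j)) (f (?N + j))) / 2 ^ k"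
    and hP: "\<And>x y. (\<Sum>i<?N. cinner x (h i) * cinner (h i) y)
      = (\<Sum>i<?N. cinner x (f (?N + i)) * cinner (f (?N + i)) y)"
    using Suc[of "\<lambda>i. f (?N + i)"] by blast
  let ?mix = "\<lambda>i p q. B p p = (B (g i) (g i) + B (h i) (h i)) / 2 \<and>
    B q q = (B (g i) (g i) + B (h i) (h i)) / 2 \<and>
    (\<forall>x y. cinner x p * cinner p y + cinner x q * cinner q y
      = cinner x (g i) * cinner (g i) y + cinner x (h i) * cinner (h i) y)"
  have "\<forall>i. \<exists>p q. ?mix i p q" by (intro allI equalize_pair[OF B])
  then obtain p q where mix: "\<forall>i. ?mix i (p i) (q i)" unfolding choice_iff by (elim exE)
  have p: "B (p i) (p i) = (B (g i) (g i) + B (h i) (h i)) / 2"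
    and q: "B (q i) (q i) = (B (g i) (g i) + B (h i) (h i)) / 2"
    and pq: "cinner x (p i) * cinner (p i) y + cinner x (q i) * cinner (q i) y
      = cinner x (g i) * cinner (g i) y + cinner x (h i) * cinner (h i) y" for i x y
    using mix by blast+
  define r where "r i = (if i < ?N then p i else q (i - ?N))" for i
  have N: "2 ^ Suc k = ?N + ?N" by simp
  have avg: "(B (g i) (g i) + B (h i) (h i)) / 2 = (\<Sum>j<2 ^ Suc k. B (f j) (f j)) / 2 ^ Suc k"
    if "i < ?N" for i
    unfolding N sum_lessThan_add g[OF that] h[OF that] by (simp add: add_divide_distrib mult.commute)
  have "B (r i) (r i) = (\<Sum>j<2 ^ Suc k. B (f j) (f j)) / 2 ^ Suc k" if "i < 2 ^ Suc k" for i
  proof (cases "i < ?N")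
    case True
    then show ?thesis by (simp only: r_def if_True p avg)
  next
    case False
    then have "i - ?N < ?N" using that by simp
    with False show ?thesis by (simp only: r_def if_False q avg)
  qed
  moreover have "(\<Sum>i<2 ^ Suc k. cinner x (r i) * cinner (r i) y)
      = (\<Sum>i<2 ^ Suc k. cinner x (f i) * cinner (f i) y)" for x y
  proof -
    have "(\<Sum>i<2 ^ Suc k. cinner x (r i) * cinner (r i) y)
        = (\<Sum>i<?N. cinner x (p i) * cinner (p i) y + cinner x (q i) * cinner (q i) y)"
      unfolding N sum_lessThan_add by (simp add: r_def sum.distrib)
    also have "\<dots> = (\<Sum>i<2 ^ Suc k. cinner x (f i) * cinner (f i) y)"
      unfolding N sum_lessThan_add by (simp add: pq sum.distrib gP hP)
    finally show ?thesis .
  qed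
  ultimately show ?case by blast
qed

section \<open>Parseval frames\<close>

text \<open>Gram-Schmidt: the residual of each new vector is normalized and adjoined unless it is
  zero. Earlier expansions survive because the adjoined vector is orthogonal to all of them.\<close>

lemma ex_orthonormal_expansion:
  fixes S :: "'a::complex_inner set"
  assumes "finite S"
  shows "\<exists>F. finite F \<and> (\<forall>f\<in>F. \<forall>g\<in>F. cinner f g = (if f = g then 1 else 0)) \<and>
    (\<forall>x\<in>S. x = (\<Sum>f\<in>F. cinner f x *\<^sub>C f))"
  using assms
proof (induction S)
  case empty
  show ?case by (rule exI[of _ "{}"]) simp
next
  case (insert b S)
  obtain F where F: "finite F"
    and on: "\<And>f g. f \<in> F \<Longrightarrow> g \<in> F \<Longrightarrow> cinner f g = (if f = g then 1 else 0)"
    and ex: "\<And>x. x \<in> S \<Longrightarrow> x = (\<Sum>f\<in>F. cinner f x *\<^sub>C f)"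
    using insert.IH by blast
  define r where "r = b - (\<Sum>f\<in>F. cinner f b *\<^sub>C f)"
  have b: "b = (\<Sum>f\<in>F. cinner f b *\<^sub>C f) + r" by (simp add: r_def)
  show ?case
  proof (cases "r = 0")
    case True
    then show ?thesis using F on ex b by (intro exI[of _ F]) auto
  next
    case False
    have Fr: "cinner g r = 0" if "g \<in> F" for g
    proof -
      have "(\<Sum>f\<in>F. cinner f b * cinner g f) = (\<Sum>f\<in>F. if f = g then cinner g b else 0)"
        by (rule sum.cong) (use that in \<open>auto simp: on\<close>)
      then show ?thesis
        using that F by (simp add: r_def cinner_diff_right cinner_sum_right cinner_scaleC_right)
    qed
    have rF: "cinner r g = 0" if "g \<in> F" for g
      using Fr[OF that] by (metis cinner_commute complex_cnj_zero)
    define \<rho> where "\<rho> = sqrt (Re (cinner r r))"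
    have im: "Im (cinner r r) = 0"
      using arg_cong[OF cinner_commute[of r r], of Im] by simp
    have "Re (cinner r r) \<noteq> 0"
      using False im by (metis cinner_eq_zero_iff complex_eq_iff zero_complex.sel)
    then have \<rho>: "\<rho> > 0" using cinner_ge_zero[of r] by (simp add: \<rho>_def)
    have "\<rho>\<^sup>2 = Re (cinner r r)" using cinner_ge_zero[of r] by (simp add: \<rho>_def)
    then have rr: "cinner r r = of_real \<rho> * of_real \<rho>"
      using im by (simp add: complex_eq_iff power2_eq_square)
    define g where "g = of_real (1 / \<rho>) *\<^sub>C r"
    have gg: "cinner g g = 1" and gF: "\<And>f. f \<in> F \<Longrightarrow> cinner g f = 0" "\<And>f. f \<in> F \<Longrightarrow> cinner f g = 0"
      using \<rho> by (simp_all add: g_def cinner_scaleC_left cinner_scaleC_right rr Fr rF)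
    then have gnF: "g \<notin> F" by fastforce
    have gs: "cinner g (\<Sum>f\<in>F. a f *\<^sub>C f) = 0" for a
      by (simp add: cinner_sum_right cinner_scaleC_right gF)
    have "cinner g b = of_real \<rho>"
      using \<rho> gs by (subst b) (simp add: cinner_add_right g_def cinner_scaleC_left rr)
    then have "cinner g b *\<^sub>C g = r"
      using \<rho> by (simp add: g_def scaleC_scaleC scaleC_one)
    then have "b = (\<Sum>f\<in>insert g F. cinner f b *\<^sub>C f)"
      using b F gnF by (simp add: add.commute)
    moreover have "x = (\<Sum>f\<in>insert g F. cinner f x *\<^sub>C f)" if "x \<in> S" for x
    proof -
      have "cinner g x = 0" using gs ex[OF that] by metis
      then show ?thesis using F gnF ex[OF that] by simp
    qed
    moreover have "\<forall>f\<in>insert g F. \<forall>h\<in>insert g F. cinner f h = (if f = h then 1 else 0)"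
      using gg gF gnF on by auto
    ultimately show ?thesis using F by (intro exI[of _ "insert g F"]) blast
  qed
qed

text \<open>An orthonormal basis followed by zeros. The identity holds for every length from
  \<open>m\<close> on, which leaves the length free to be a power of two.\<close>

lemma ex_parseval_frame:
  assumes "finite_dimensional (UNIV :: 'a::complex_inner set)"
  shows "\<exists>m (f :: nat \<Rightarrow> 'a). \<forall>l\<ge>m. \<forall>x y. (\<Sum>i<l. cinner x (f i) * cinner (f i) y) = cinner x y"
proof -
  obtain S :: "'a set" where S: "finite S" "cspan S = UNIV"
    using assms by (auto simp: finite_dimensional_def)
  obtain F where F: "finite F" and ex: "\<And>x. x \<in> S \<Longrightarrow> x = (\<Sum>f\<in>F. cinner f x *\<^sub>C f)"
    using ex_orthonormal_expansion[OF S(1)] by blast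
  \<comment> \<open>Both sides are linear in \<open>y\<close>, so the expansion extends from the
    spanning set \<open>S\<close> to the whole space.\<close>
  have exp: "y = (\<Sum>f\<in>F. cinner f y *\<^sub>C f)" for y
  proof -
    have "y \<in> cspan S" by (simp add: S)
    then show ?thesis
    proof (induction rule: complex_vector.span_induct_alt)
      case base
      then show ?case by simp
    next
      case (step c x y)
      have "(\<Sum>f\<in>F. cinner f (c *\<^sub>C x + y) *\<^sub>C f)
          = c *\<^sub>C (\<Sum>f\<in>F. cinner f x *\<^sub>C f) + (\<Sum>f\<in>F. cinner f y *\<^sub>C f)"
        by (simp add: cinner_add_right cinner_scaleC_right scaleC_add_left scaleC_scaleC
            complex_vector.scale_sum_right sum.distrib)
      then show ?case using ex[OF step(1)] step(2) by simp
    qed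
  qed
  obtain h where h: "bij_betw h {..<card F} F"
    using F by (metis ex_bij_betw_nat_finite lessThan_atLeast0)
  define f where "f i = (if i < card F then h i else 0)" for i
  have "(\<Sum>i<l. cinner x (f i) * cinner (f i) y) = cinner x y" if "l \<ge> card F" for l x y
  proof -
    have "(\<Sum>i<l. cinner x (f i) * cinner (f i) y) = (\<Sum>i<card F. cinner x (f i) * cinner (f i) y)"
      by (rule sum.mono_neutral_right) (use that in \<open>auto simp: f_def\<close>)
    also have "\<dots> = (\<Sum>i<card F. cinner x (h i) * cinner (h i) y)"
      by (simp add: f_def)
    also have "\<dots> = (\<Sum>g\<in>F. cinner x g * cinner g y)"
      by (rule sum.reindex_bij_betw[OF h])
    also have "\<dots> = cinner x (\<Sum>f\<in>F. cinner f y *\<^sub>C f)"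
      by (simp add: cinner_sum_right cinner_scaleC_right mult.commute)
    finally show ?thesis using exp[of y] by simp
  qed
  then show ?thesis by blast
qed

section \<open>Partial inner products\<close>

text \<open>\<open>(\<langle>u| \<otimes> I)\<close> applied to the tensor represented by \<open>xs\<close>.\<close>

definition contract :: "('a::complex_inner \<times> 'b::complex_inner) list \<Rightarrow> 'a \<Rightarrow> 'b"
  where "contract xs u = (\<Sum>(x, y)\<leftarrow>xs. cinner u x *\<^sub>C y)"

lemma contract_Nil: "contract [] u = 0"
  and contract_Cons: "contract ((x, y) # xs) u = cinner u x *\<^sub>C y + contract xs u"
  by (simp_all add: contract_def)

lemma cinner_contract: "cinner v (contract xs u) = tensor_form xs u v"
  by (induction xs) (auto simp: contract_Nil contract_Cons tensor_form_Nil tensor_form_Cons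
      cinner_add_right cinner_scaleC_right)

lemma contract_add: "contract xs (u + v) = contract xs u + contract xs v"
  by (induction xs) (auto simp: contract_Nil contract_Cons cinner_add_left scaleC_add_left)

lemma contract_scaleC: "contract xs (a *\<^sub>C u) = cnj a *\<^sub>C contract xs u"
  by (induction xs) (auto simp: contract_Nil contract_Cons cinner_scaleC_left scaleC_add_right
      scaleC_scaleC)

text \<open>\<open>contract\<close> is conjugate-linear, so \<open>v\<close> must stand in the
  conjugate-linear slot of the inner product to give a form linear in its second argument.\<close>

lemma sesquilinear_contract: "sesquilinear (\<lambda>u v. cinner (contract xs v) (contract ys u))"
  by (simp add: sesquilinear_def contract_add contract_scaleC cinner_add_left cinner_add_right
      cinner_scaleC_left cinner_scaleC_right)

text \<open>The resolution of the identity given by the frame is inserted in the first tensor factor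
  of <S|T>.\<close>

lemma sum_cinner_contract:
  assumes f: "\<And>x y. (\<Sum>i<l. cinner x (f i) * cinner (f i) y) = cinner x y"
  shows "(\<Sum>i<l. cinner (contract (tensor_rep S) (f i)) (contract (tensor_rep T) (f i))) = cinner S T"
proof -
  have tf: "(\<Sum>i<l. cinner x (f i) * tensor_form ys (f i) y) = tensor_form ys x y" for x y ys
  proof (induction ys)
    case Nil
    then show ?case by (simp add: tensor_form_Nil)
  next
    case (Cons p ys)
    obtain a b where p: "p = (a, b)" by (cases p)
    have "(\<Sum>i<l. cinner x (f i) * tensor_form (p # ys) (f i) y)
        = (\<Sum>i<l. cinner x (f i) * cinner (f i) a) * cinner y b
          + (\<Sum>i<l. cinner x (f i) * tensor_form ys (f i) y)"
      by (simp add: p tensor_form_Cons algebra_simps sum.distrib sum_distrib_left)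
    then show ?case by (simp add: p f Cons tensor_form_Cons)
  qed
  have "(\<Sum>i<l. cinner (contract xs (f i)) (contract ys (f i)))
      = (\<Sum>(x, y)\<leftarrow>xs. tensor_form ys x y)" for xs ys
  proof (induction xs)
    case Nil
    then show ?case by (simp add: contract_Nil)
  next
    case (Cons p xs)
    obtain a b where p: "p = (a, b)" by (cases p)
    have "cinner (contract (p # xs) (f i)) (contract ys (f i))
        = cinner a (f i) * tensor_form ys (f i) b + cinner (contract xs (f i)) (contract ys (f i))" for i
      by (simp add: p contract_Cons cinner_add_left cinner_scaleC_left
          flip: cinner_commute cinner_contract)
    then show ?case using Cons tf by (simp add: p sum.distrib)
  qed
  then show ?thesis by (simp add: cinner_tensor_def form_of_tensor_rep[of T])
qed

lemma tensor_sum_left: "(\<Sum>i\<in>I. f i) \<otimes>\<^sub>C y = (\<Sum>i\<in>I. f i \<otimes>\<^sub>C y)"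
proof (induction I rule: infinite_finite_induct)
  case (infinite I)
  then show ?case by (auto intro!: tensor_eqI simp: form_of_tensor form_of_zero)
next
  case empty
  then show ?case by (auto intro!: tensor_eqI simp: form_of_tensor form_of_zero)
next
  case (insert i I)
  then show ?case by (simp add: tensor_add_left)
qed

text \<open>On elementary tensors the scalar <f_i|x> moves from \<open>e i\<close> across the tensor
  sign to \<open>y\<close>, where it forms the partial inner product; linearity of the operator does
  the rest.\<close>

lemma tensor_op_expand:
  fixes T :: "('a::complex_inner, 'b::complex_inner) tensor"
  assumes V: "clinear V" and Vx: "\<And>x. V x = (\<Sum>i\<in>I. cinner (f i) x *\<^sub>C e i)"
  shows "tensor_op V id T = (\<Sum>i\<in>I. e i \<otimes>\<^sub>C contract (tensor_rep T) (f i))"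
proof -
  have id: "clinear (id :: 'b \<Rightarrow> 'b)" by (simp add: clinear_iff)
  define F where "F = tensor_op V (id :: 'b \<Rightarrow> 'b)"
  have F: "F (S + T) = F S + F T" "F (a *\<^sub>C T) = a *\<^sub>C F T" for S T a
    using clinear_tensor_op[OF V id] by (simp_all add: clinear_iff F_def)
  have F0: "F 0 = 0" using F by (metis complex_vector.scale_zero_left)
  have "F (\<Sum>(x, y)\<leftarrow>xs. x \<otimes>\<^sub>C y) = (\<Sum>i\<in>I. e i \<otimes>\<^sub>C contract xs (f i))" for xs
  proof (induction xs)
    case Nil
    have "x \<otimes>\<^sub>C (0::'b) = 0" for x :: 'c
      by (auto intro!: tensor_eqI simp: form_of_tensor form_of_zero)
    then show ?case by (simp add: F0 contract_Nil)
  next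
    case (Cons p xs)
    obtain x y where p: "p = (x, y)" by (cases p)
    have "F (x \<otimes>\<^sub>C y) = (\<Sum>i\<in>I. e i \<otimes>\<^sub>C (cinner (f i) x *\<^sub>C y))"
      by (simp add: F_def tensor_op_tensor[OF V id] Vx tensor_sum_left tensor_scaleC_left tensor_scaleC_right)
    then show ?case
      using F Cons by (simp add: p contract_Cons tensor_add_right sum.distrib)
  qed
  then show ?thesis unfolding F_def using tensor_sum_list[of T] by metis
qed

section \<open>The standard basis of finitely supported sequences\<close>

abbreviation std :: "nat \<Rightarrow> nat \<Rightarrow>\<^sub>0 complex"
  where "std i \<equiv> Poly_Mapping.single i 1"

lemma cinner_std: "cinner (std i) p = Poly_Mapping.lookup p i"
  by (simp add: cinner_poly_mapping_def cinner_complex_def)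

lemma lookup_std_expansion:
  assumes "finite I"
  shows "Poly_Mapping.lookup (\<Sum>i\<in>I. a i *\<^sub>C std i) j = (if j \<in> I then a j else 0)"
  using assms by (simp add: lookup_sum lookup_scaleC lookup_single scaleC_complex_def when_def
      if_distrib[of "\<lambda>x. _ * x"] cong: if_cong)

lemma std_orthonormal_basis: "is_orthonormal_basis std l (cspan (std ` {1..l}))"
  by (simp add: is_orthonormal_basis_def cinner_std lookup_single when_def)

lemma cdim_std: "cdim (cspan (std ` {1..l})) = l"
proof -
  have inj: "inj_on std {1..l}" by (intro inj_onI) (metis lookup_single_eq lookup_single_not_eq zero_neq_one)
  have "\<not> complex_vector.dependent (std ` {1..l})"
  proof
    assume "complex_vector.dependent (std ` {1..l})"
    then obtain a j where 0: "(\<Sum>q\<in>std ` {1..l}. a q *\<^sub>C q) = 0"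
      and j: "j \<in> {1..l}" "a (std j) \<noteq> 0"
      by (auto simp: complex_vector.dependent_finite)
    from 0 have "(\<Sum>i\<in>{1..l}. a (std i) *\<^sub>C std i) = 0"
      by (simp only: sum.reindex[OF inj] o_def)
    then show False
      \<comment> \<open>Coordinate \<open>j\<close> of the vanishing combination is its coefficient
        at \<open>std j\<close>, which was chosen nonzero.\<close>
      using lookup_std_expansion[of "{1..l}" "\<lambda>i. a (std i)" j] j by simp
  qed
  then show ?thesis
    by (simp add: complex_vector.dim_span complex_vector.dim_eq_card_independent card_image[OF inj]
        del: One_nat_def)
qed

section \<open>The isometry built from an equalized Parseval frame\<close>

theorem mainTheorem2:
  fixes \<psi> \<phi> :: "('a::complex_inner, 'b::complex_inner) tensor"
    and n :: nat
  assumes "finite_dimensional (UNIV :: 'a set)" and "finite_dimensional (UNIV :: 'b set)"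
    and "cdim (UNIV :: 'a set) = n" and "n \<ge> 1"
    and "cnorm \<psi> = 1" and "cnorm \<phi> = 1"
    and "cinner \<psi> \<phi> = 0"
  shows "\<exists>(l::nat) (HA' :: (nat \<Rightarrow>\<^sub>0 complex) set) (V :: 'a \<Rightarrow> nat \<Rightarrow>\<^sub>0 complex)
      (e :: nat \<Rightarrow> nat \<Rightarrow>\<^sub>0 complex) (\<eta> :: nat \<Rightarrow> 'b) (\<eta>' :: nat \<Rightarrow> 'b).
    l \<ge> n \<and>
    csubspace HA' \<and> finite_dimensional HA' \<and> cdim HA' = l \<and>
    is_isometry V \<and> range V \<subseteq> HA' \<and>
    is_orthonormal_basis e l HA' \<and>
    tensor_op V id \<psi> = (\<Sum>i=1..l. e i \<otimes>\<^sub>C \<eta> i) \<and>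
    tensor_op V id \<phi> = (\<Sum>i=1..l. e i \<otimes>\<^sub>C \<eta>' i) \<and>
    (\<forall>i\<in>{1..l}. cinner (\<eta> i) (\<eta>' i) = 0)"
proof -
  let ?c = "contract (tensor_rep \<psi>)" and ?c' = "contract (tensor_rep \<phi>)"
  obtain m and f :: "nat \<Rightarrow> 'a"
    where f: "\<And>l x y. l \<ge> m \<Longrightarrow> (\<Sum>i<l. cinner x (f i) * cinner (f i) y) = cinner x y"
    using ex_parseval_frame[OF assms(1)] by blast
  \<comment> \<open>Since \<open>2 ^ k > k = n + m\<close>, the length \<open>l\<close> is at least
    \<open>n\<close>, as claimed, and at least \<open>m\<close>, so that \<open>f\<close> is a
    Parseval frame of length \<open>l\<close>.\<close>
  define k l where "k = n + m" and "l = (2::nat) ^ k"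
  have "l > k" by (simp add: l_def)
  then have ln: "l \<ge> n" and lm: "l \<ge> m" by (simp_all add: k_def)
  have "\<exists>g. (\<forall>i<l. cinner (?c (g i)) (?c' (g i)) = (\<Sum>j<l. cinner (?c (f j)) (?c' (f j))) / 2 ^ k) \<and>
      (\<forall>x y. (\<Sum>i<l. cinner x (g i) * cinner (g i) y) = (\<Sum>i<l. cinner x (f i) * cinner (f i) y))"
    unfolding l_def by (rule equalize_family[OF sesquilinear_contract])
  then obtain g where g0: "\<forall>i<l. cinner (?c (g i)) (?c' (g i))
        = (\<Sum>j<l. cinner (?c (f j)) (?c' (f j))) / 2 ^ k"
    and "\<forall>x y. (\<Sum>i<l. cinner x (g i) * cinner (g i) y) = (\<Sum>i<l. cinner x (f i) * cinner (f i) y)"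
    by (elim exE conjE)
  then have g: "(\<Sum>i<l. cinner x (g i) * cinner (g i) y) = cinner x y" for x y
    by (simp add: f[OF lm])
  \<comment> \<open>Every diagonal value equals the average, and the values of the frame
    \<open>f\<close> add up to <\<psi>|\<phi>> = 0.\<close>
  have diag: "cinner (?c (g i)) (?c' (g i)) = 0" if "i < l" for i
    using g0 that sum_cinner_contract[OF f[OF lm], of \<psi> \<phi>] assms(7) by simp
  \<comment> \<open>Shifts the frame from indices 0, ..., l - 1 to the indices 1, ..., l of the
    basis.\<close>
  define h where "h i = g (i - 1)" for i
  have h: "(\<Sum>i=1..l. cinner x (h i) * cinner (h i) y) = cinner x y" for x y
    using g[of x y] by (simp add: h_def sum.atLeast1_atMost_eq)
  define V where "V x = (\<Sum>i=1..l. cinner (h i) x *\<^sub>C std i)" for x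
  have V: "clinear V"
    by (simp add: clinear_iff V_def cinner_add_right cinner_scaleC_right scaleC_add_left
        sum.distrib complex_vector.scale_sum_right scaleC_scaleC)
  have "cinner (V x) (V x) = cinner x x" for x
  proof -
    have "cinner (V x) (std i) = cinner x (h i)" if "i \<in> {1..l}" for i
    proof -
      have "cinner (std i) (V x) = cinner (h i) x"
        using that by (simp add: cinner_std V_def lookup_std_expansion)
      then show ?thesis by (metis cinner_commute)
    qed
    \<comment> \<open>Only the right-hand copy of \<open>V x\<close> is expanded; the resulting sum
      is the Parseval identity for \<open>h\<close> at the pair x, x.\<close>
    then have "cinner (V x) (\<Sum>i=1..l. cinner (h i) x *\<^sub>C std i) = (\<Sum>i=1..l. cinner x (h i) * cinner (h i) x)"
      by (simp add: cinner_sum_right cinner_scaleC_right mult.commute)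
    then show ?thesis unfolding h V_def[of x, symmetric] .
  qed
  then have iso: "is_isometry V" using V by (simp add: is_isometry_def cnorm_def)
  let ?H = "cspan (std ` {1..l})"
  have "V x \<in> ?H" for x
    unfolding V_def
  proof (rule complex_vector.span_sum)
    fix i assume "i \<in> {1..l}"
    then have "std i \<in> ?H" by (intro complex_vector.span_base imageI)
    then show "cinner (h i) x *\<^sub>C std i \<in> ?H" by (rule complex_vector.span_scale)
  qed
  then have range: "range V \<subseteq> ?H" by blast
  have fin: "finite_dimensional ?H"
    unfolding finite_dimensional_def by blast
  have zero: "\<forall>i\<in>{1..l}. cinner (?c (h i)) (?c' (h i)) = 0"
    by (auto simp: h_def intro!: diag)
  show ?thesis
  proof (intro exI conjI)
    show "l \<ge> n" by (rule ln)
    show "csubspace ?H" by (rule complex_vector.subspace_span)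
    show "finite_dimensional ?H" by (rule fin)
    show "cdim ?H = l" by (rule cdim_std)
    show "is_isometry V" by (rule iso)
    show "range V \<subseteq> ?H" by (rule range)
    show "is_orthonormal_basis std l ?H" by (rule std_orthonormal_basis)
    show "tensor_op V id \<psi> = (\<Sum>i=1..l. std i \<otimes>\<^sub>C ?c (h i))"
      and "tensor_op V id \<phi> = (\<Sum>i=1..l. std i \<otimes>\<^sub>C ?c' (h i))"
      by (rule tensor_op_expand[OF V V_def])+
    show "\<forall>i\<in>{1..l}. cinner (?c (h i)) (?c' (h i)) = 0" by (rule zero)
  qed
qed

end
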